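(* Let $\Omega\subset\mathbb{R}^d$ be a bounded polytopal Lipschitz domain with a simplicial triangulation $\Sigma_h$, and let $H:\overline\Omega\times\mathbb{R}^d\to\mathbb{R}$ satisfy: (i) $H\in C(\overline\Omega\times\mathbb{R}^d)$; (ii) $p\mapsto H(x,p)$ is convex for all $x\in\overline\Omega$; (iii) $H(x,p)\to\infty$ as $\|p\|\to\infty$, uniformly in $x\in\overline\Omega$; (iv) $H(x,0)<0$ for all $x\in\Omega$. Let $u_h,v_h\in V_h$ be a finite-element subsolution and a finite-element supersolution, respectively, that is, $u_h\le\Lambda_hu_h$ and $v_h\ge\Lambda_hv_h$. If $u_h\le v_h$ on $\partial\Omega_h$, then $u_h\le v_h$ on $\overline\Omega$.
   Context: $\|\cdot\|$ is the Euclidean norm and $\langle\cdot,\cdot\rangle$ the Euclidean inner product on $\mathbb{R}^d$. Support function: $\rho(x,q)=\max_{H(x,p)=0}\langle p,q\rangle=\sup_{H(x,p)\le0}\langle p,q\rangle$ for $x\in\overline\Omega$, $q\in\mathbb{R}^d$. (By continuity, (iv) implies $H(x,0)\le 0$ on $\overline\Omega$, so $\rho$ is well defined.) $V_h$ is the space of linear finite elements on $\Sigma_h$: continuous functions on $\overline\Omega$ that are affine on each simplex $\sigma\in\Sigma_h$. $\overline\Omega_h,\Omega_h,\partial\Omega_h$ denote the sets of nodal points (vertices of $\Sigma_h$) belonging to $\overline\Omega,\Omega,\partial\Omega$, respectively. For $x_h\in\Omega_h$, $\omega_h(x_h)$ is the interior of the union of all simplices of $\Sigma_h$ that have $x_h$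 as a vertex. Hopf–Lax update function: $\Lambda_h:V_h\to V_h$ is given by the nodal values \[ (\Lambda_hu_h)(x_h)=\min_{y\in\partial\omega_h(x_h)}\bigl(u_h(y)+\rho(x_h,x_h-y)\bigr)\ \ (x_h\in\Omega_h),\qquad(\Lambda_hu_h)(x_h)=u_h(x_h)\ \ (x_h\in\partial\Omega_h). \] *)

theory Defs
  imports "HOL-Analysis.Analysis"
begin

text \<open>
  After a rotation taking \<open>e\<close> to the last coordinate direction: near each boundary point,
  \<open>\<Omega>\<close> is the strict subgraph of a Lipschitz function on the hyperplane orthogonal to \<open>e\<close>.
\<close>

definition lipschitz_boundary :: "'a::euclidean_space set \<Rightarrow> bool" where
  "lipschitz_boundary \<Omega> \<longleftrightarrow>
     (\<forall>x\<in>frontier \<Omega>. \<exists>e r L. \<exists>g :: 'a \<Rightarrow> real.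
        norm e = 1 \<and> r > 0 \<and> L-lipschitz_on {z. z \<bullet> e = 0} g \<and>
        \<Omega> \<inter> ball x r = {y \<in> ball x r. y \<bullet> e < g (y - (y \<bullet> e) *\<^sub>R e)})"

definition bounded_polytopal_lipschitz_domain :: "'a::euclidean_space set \<Rightarrow> bool" where
  "bounded_polytopal_lipschitz_domain \<Omega> \<longleftrightarrow>
     open \<Omega> \<and> connected \<Omega> \<and> \<Omega> \<noteq> {} \<and> bounded \<Omega> \<and>
     (\<exists>\<P>. finite \<P> \<and> (\<forall>P\<in>\<P>. polytope P) \<and> closure \<Omega> = \<Union>\<P>) \<and>
     lipschitz_boundary \<Omega>"

text \<open>
  The mesh consists of its closed full-dimensional simplices only; lower-dimensional faces are
  not members. The library predicate \<^const>\<open>triangulation\<close> says that the mesh is finite and that any two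
  simplices meet in a common (possibly empty) face.
\<close>

definition mesh_of :: "'a::euclidean_space set set \<Rightarrow> 'a set \<Rightarrow> bool" where
  "mesh_of \<Sigma> \<Omega> \<longleftrightarrow>
     triangulation \<Sigma> \<and> (\<forall>\<sigma>\<in>\<Sigma>. int DIM('a) simplex \<sigma>) \<and> \<Union>\<Sigma> = closure \<Omega>"

definition nodes :: "'a::euclidean_space set set \<Rightarrow> 'a set" where
  "nodes \<Sigma> = {x. \<exists>\<sigma>\<in>\<Sigma>. x extreme_point_of \<sigma>}"

definition patch :: "'a::euclidean_space set set \<Rightarrow> 'a \<Rightarrow> 'a set" where
  "patch \<Sigma> x = interior (\<Union>{\<sigma>\<in>\<Sigma>. x extreme_point_of \<sigma>})"

text \<open>
  Elements of \<open>V\<^sub>h\<close> are represented by total functions of which only the restriction to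
  the closure of \<open>\<Omega>\<close> matters.
\<close>

definition fe_space :: "'a::euclidean_space set set \<Rightarrow> 'a set \<Rightarrow> ('a \<Rightarrow> real) set" where
  "fe_space \<Sigma> \<Omega> =
     {u. continuous_on (closure \<Omega>) u \<and>
         (\<forall>\<sigma>\<in>\<Sigma>. \<exists>a c. \<forall>x\<in>\<sigma>. u x = a \<bullet> x + c)}"

definition support_fun :: "('a::euclidean_space \<Rightarrow> 'a \<Rightarrow> real) \<Rightarrow> 'a \<Rightarrow> 'a \<Rightarrow> real" where
  "support_fun H x q = (SUP p\<in>{p. H x p \<le> 0}. p \<bullet> q)"

lemma support_fun_is_max:
  fixes H :: "'a::euclidean_space \<Rightarrow> 'a \<Rightarrow> real"
  assumes cont: "continuous_on UNIV (H x)"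
    and coercive: "filterlim (H x) at_top at_infinity"
    and zero: "H x 0 \<le> 0"
  shows "\<exists>p. H x p = 0 \<and> support_fun H x q = p \<bullet> q"
    and "H x p \<le> 0 \<Longrightarrow> p \<bullet> q \<le> support_fun H x q"
proof -
  define K where "K = {p. H x p \<le> 0}"
  have "closed K"
    unfolding K_def by (intro closed_Collect_le cont continuous_on_const)
  moreover have "bounded K"
  proof -
    have "eventually (\<lambda>p. H x p > 0) at_infinity"
      using coercive by (auto simp: filterlim_at_top_dense)
    then obtain b where "\<And>p. norm p \<ge> b \<Longrightarrow> H x p > 0"
      by (auto simp: eventually_at_infinity)
    then show ?thesis
      unfolding K_def bounded_iff by (metis linorder_le_cases mem_Collect_eq not_le)
  qed
  ultimately have K: "compact K"
    by (simp add: compact_eq_bounded_closed)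
  have ne: "K \<noteq> {}"
    using zero by (auto simp: K_def)
  have sup: "support_fun H x r = p \<bullet> r"
    if "p \<in> K" "\<And>p'. p' \<in> K \<Longrightarrow> p' \<bullet> r \<le> p \<bullet> r" for p r
    unfolding support_fun_def K_def[symmetric] using that by (intro cSup_eq_maximum) auto
  have att: "\<exists>p\<in>K. \<forall>p'\<in>K. p' \<bullet> r \<le> p \<bullet> r" for r
    by (rule continuous_attains_sup[OF K ne]) (intro continuous_intros)
  have bd: "H x p = 0" if "p \<in> K" "\<And>p'. p' \<in> K \<Longrightarrow> p' \<bullet> r \<le> p \<bullet> r" "r \<noteq> 0" for p r
  proof (rule ccontr)
    assume "H x p \<noteq> 0"
    then have "H x p < 0" using that by (auto simp: K_def)
    moreover have "open {p. H x p < 0}"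
      by (intro open_Collect_less cont continuous_on_const)
    ultimately obtain \<epsilon> where e: "\<epsilon> > 0" "\<And>y. dist y p < \<epsilon> \<Longrightarrow> H x y < 0"
      by (auto simp: open_dist)
    define y where "y = p + (\<epsilon> / (2 * norm r)) *\<^sub>R r"
    have "dist y p < \<epsilon>" using e(1) that(3) by (simp add: y_def dist_norm)
    then have "y \<in> K" using e(2)[of y] by (simp add: K_def)
    then have "y \<bullet> r \<le> p \<bullet> r" using that(2) by blast
    then have "(\<epsilon> / (2 * norm r)) * (r \<bullet> r) \<le> 0" by (simp add: y_def inner_add_left)
    moreover have "(\<epsilon> / (2 * norm r)) * (r \<bullet> r) > 0"
      using e(1) that(3) by (intro mult_pos_pos) auto
    ultimately show False by linarith
  qed
  show "\<exists>p. H x p = 0 \<and> support_fun H x q = p \<bullet> q"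
  proof (cases "q = 0")
    case False
    then show ?thesis using att[of q] bd[of _ q] sup[of _ q] by blast
  next
    case True
    obtain b :: 'a where "b \<noteq> 0" using nonzero_Basis nonempty_Basis by blast
    then obtain p where "H x p = 0" using att[of b] bd[of _ b] by blast
    then show ?thesis using True sup[of p q] by (auto simp: K_def)
  qed
  show "p \<bullet> q \<le> support_fun H x q" if "H x p \<le> 0"
    using that att[of q] sup[of _ q] by (auto simp: K_def)
qed

text \<open>
  \<open>LEAST m\<close> over the set of attained values is the minimum of that set. In \<open>hopf_lax\<close>, the
  nodal values determine the function on the closure of \<open>\<Omega>\<close>, so the choice made by \<open>SOME\<close>
  affects only points outside the closure.
\<close>

definition hopf_lax_value ::
    "('a::euclidean_space \<Rightarrow> 'a \<Rightarrow> real) \<Rightarrow> 'a set set \<Rightarrow> ('a \<Rightarrow> real) \<Rightarrow> 'a \<Rightarrow> real" where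
  "hopf_lax_value H \<Sigma> u x =
     (LEAST m. m \<in> (\<lambda>y. u y + support_fun H x (x - y)) ` frontier (patch \<Sigma> x))"

definition hopf_lax ::
    "('a::euclidean_space \<Rightarrow> 'a \<Rightarrow> real) \<Rightarrow> 'a set set \<Rightarrow> 'a set \<Rightarrow> ('a \<Rightarrow> real) \<Rightarrow> 'a \<Rightarrow> real" where
  "hopf_lax H \<Sigma> \<Omega> u =
     (SOME w. w \<in> fe_space \<Sigma> \<Omega> \<and>
        (\<forall>x \<in> nodes \<Sigma> \<inter> \<Omega>. w x = hopf_lax_value H \<Sigma> u x) \<and>
        (\<forall>x \<in> nodes \<Sigma> \<inter> frontier \<Omega>. w x = u x))"

definition fe_subsolution ::
    "('a::euclidean_space \<Rightarrow> 'a \<Rightarrow> real) \<Rightarrow> 'a set set \<Rightarrow> 'a set \<Rightarrow> ('a \<Rightarrow> real) \<Rightarrow> bool" where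
  "fe_subsolution H \<Sigma> \<Omega> u \<longleftrightarrow>
     u \<in> fe_space \<Sigma> \<Omega> \<and> (\<forall>x\<in>closure \<Omega>. u x \<le> hopf_lax H \<Sigma> \<Omega> u x)"

definition fe_supersolution ::
    "('a::euclidean_space \<Rightarrow> 'a \<Rightarrow> real) \<Rightarrow> 'a set set \<Rightarrow> 'a set \<Rightarrow> ('a \<Rightarrow> real) \<Rightarrow> bool" where
  "fe_supersolution H \<Sigma> \<Omega> v \<longleftrightarrow>
     v \<in> fe_space \<Sigma> \<Omega> \<and> (\<forall>x\<in>closure \<Omega>. v x \<ge> hopf_lax H \<Sigma> \<Omega> v x)"

end

theory Submission
  imports Defs
begin

text \<open>
  Let \<open>\<delta>\<close> be the maximum of \<open>u - v\<close> and suppose \<open>\<delta> > 0\<close>. Among the maximum points choose one where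
  \<open>v\<close> is smallest; as \<open>u\<close> and \<open>v\<close> are affine on simplices it can be taken to be a node \<open>x\<close>, which lies
  in \<open>\<Omega>\<close> because of the boundary condition. If \<open>y\<close> attains the minimum in the update formula for
  \<open>v\<close> at \<open>x\<close>, then \<open>u x - v x \<le> u y - v y\<close>, so \<open>y\<close> is also a maximum point. But
  \<open>v y \<le> v x - \<rho>(x, x - y) < v x\<close>, since \<open>H x 0 < 0\<close> makes \<open>\<rho>\<close> positive: a contradiction.
\<close>

section \<open>Affine functions on simplices and compact convex sets\<close>

lemma affine_interpolation:
  fixes C :: "'a::euclidean_space set"
  assumes "\<not> affine_dependent C"
  obtains a c where "\<And>x. x \<in> C \<Longrightarrow> a \<bullet> x + c = f x"
proof (cases "C = {}")
  case False
  then obtain b where b: "b \<in> C" by blast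
  \<comment> \<open>Moving \<open>b\<close> to the origin turns affine into linear independence, so
    the increments \<open>f x - f b\<close> can be prescribed for a linear \<open>g\<close>.\<close>
  have "independent ((\<lambda>x. x - b) ` (C - {b}))"
    using assms affine_dependent_iff_dependent2[OF b] by simp
  from linear_independent_extend[OF this, of "\<lambda>y. f (y + b) - f b"]
  obtain g where g: "linear g"
      "\<And>y. y \<in> (\<lambda>x. x - b) ` (C - {b}) \<Longrightarrow> g y = f (y + b) - f b"
    by blast
  \<comment> \<open>\<open>adjoint g 1\<close> is the vector representing the functional
    \<open>g\<close>; the constant \<open>f b - g b\<close> matches the value at
    \<open>b\<close>.\<close>
  have "adjoint g 1 \<bullet> x + (f b - g b) = f x" if "x \<in> C" for x
  proof -
    have "adjoint g 1 \<bullet> x = g x"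
      using adjoint_works[OF g(1), of x 1] by (simp add: inner_commute)
    moreover have "g x - g b = f x - f b"
    proof (cases "x = b")
      case False
      then have "g (x - b) = f (x - b + b) - f b"
        using that by (intro g(2)) auto
      then show ?thesis by (simp add: linear_diff[OF g(1)])
    qed simp
    ultimately show ?thesis by simp
  qed
  then show ?thesis by (rule that)
qed (rule that, simp)

text \<open>Two affine functions agree on a convex set of the form
  \<open>{x. n \<bullet> x = k}\<close>, which contains the hull once it contains
  \<open>S\<close>.\<close>

lemma affine_eq_on_hull:
  fixes S :: "'a::euclidean_space set"
  assumes "\<And>x. x \<in> S \<Longrightarrow> a \<bullet> x + c = a' \<bullet> x + c'"
    and "y \<in> convex hull S"
  shows "a \<bullet> y + c = a' \<bullet> y + c'"
proof -
  have "S \<subseteq> {x. (a - a') \<bullet> x = c' - c}"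
    using assms(1) by (auto simp: inner_diff_left algebra_simps)
  then have "convex hull S \<subseteq> {x. (a - a') \<bullet> x = c' - c}"
    by (rule hull_minimal) (rule convex_hyperplane)
  then show ?thesis
    using assms(2) by (auto simp: inner_diff_left)
qed

text \<open>The maximum set of the affine \<open>w\<close> on \<open>S\<close> is a face
  \<open>F\<close>, whose extreme points are extreme in \<open>S\<close>. Since \<open>y\<close>
  lies in their convex hull, the affine \<open>v\<close> cannot exceed \<open>v y\<close> at all of
  them.\<close>

lemma extreme_point_face_min:
  fixes S :: "'a::euclidean_space set"
  assumes S: "compact S" "convex S" and y: "y \<in> S"
    and w: "\<And>x. x \<in> S \<Longrightarrow> w x = a \<bullet> x + c" "\<And>x. x \<in> S \<Longrightarrow> w x \<le> w y"
    and v: "\<And>x. x \<in> S \<Longrightarrow> v x = a' \<bullet> x + c'"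
  obtains z where "z extreme_point_of S" "w z = w y" "v z \<le> v y"
proof -
  define F where "F = S \<inter> {x. a \<bullet> x = a \<bullet> y}"
  have F: "F face_of S"
    unfolding F_def using w y S by (intro face_of_Int_supporting_hyperplane_le) auto
  then have "convex hull {x. x extreme_point_of F} = F"
    using Krein_Milman_Minkowski[of F] face_of_imp_compact[OF S(2,1) F] face_of_imp_convex[OF F] S
    by simp
  then have "y \<in> convex hull {x. x extreme_point_of F}"
    using y by (simp add: F_def)
  moreover have "\<not> {x. x extreme_point_of F} \<subseteq> {x. a' \<bullet> x > a' \<bullet> y}"
    if "y \<in> convex hull {x. x extreme_point_of F}"
    using that hull_minimal[of _ "{x. a' \<bullet> x > a' \<bullet> y}" convex] convex_halfspace_gt by blast
  ultimately obtain z where z: "z extreme_point_of F" "a' \<bullet> z \<le> a' \<bullet> y"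
    by fastforce
  then have "z \<in> F" by (simp add: extreme_point_of_def)
  with z y that show ?thesis
    using extreme_point_of_face[OF F] by (auto simp: F_def w(1) v)
qed

section \<open>The mesh and its finite-element interpolants\<close>

lemma mesh_simplexD:
  assumes "mesh_of \<Sigma> \<Omega>" "\<sigma> \<in> \<Sigma>"
  shows "compact \<sigma>" "convex \<sigma>" "\<sigma> \<subseteq> closure \<Omega>"
  using assms by (auto simp: mesh_of_def dest: compact_simplex convex_simplex)

lemma mesh_faces:
  assumes "mesh_of \<Sigma> \<Omega>" "\<sigma> \<in> \<Sigma>" "\<tau> \<in> \<Sigma>"
  shows "\<sigma> \<inter> \<tau> face_of \<sigma>" "\<sigma> \<inter> \<tau> face_of \<tau>"
proof -
  have *: "S \<inter> T face_of S" if "S \<in> \<Sigma>" "T \<in> \<Sigma>" for S T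
    using assms(1) that by (simp add: mesh_of_def triangulation_def)
  from *[OF assms(2,3)] show "\<sigma> \<inter> \<tau> face_of \<sigma>" .
  from *[OF assms(3,2)] show "\<sigma> \<inter> \<tau> face_of \<tau>" by (simp add: Int_commute)
qed

text \<open>Simplices meet in common faces, and a point of a face is extreme in the face exactly
  when it is extreme in the whole simplex; this rules out hanging nodes.\<close>

lemma mesh_node_in_simplex:
  assumes "mesh_of \<Sigma> \<Omega>" "\<sigma> \<in> \<Sigma>" "\<tau> \<in> \<Sigma>" "x extreme_point_of \<sigma>" "x \<in> \<tau>"
  shows "x extreme_point_of \<tau>"
proof -
  note f = mesh_faces[OF assms(1-3)]
  have "x \<in> \<sigma>" using assms(4) by (simp add: extreme_point_of_def)
  then have "x extreme_point_of (\<sigma> \<inter> \<tau>)"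
    using assms(4,5) extreme_point_of_face[OF f(1)] by blast
  then show ?thesis
    using extreme_point_of_face[OF f(2)] by blast
qed

text \<open>Each simplex carries an affine interpolant of the values at its vertices. On the overlap
  of two simplices both interpolants agree, the overlap being a common face spanned by vertices of
  both; so the pieces glue continuously over a finite closed cover.\<close>

lemma fe_interpolant:
  fixes f :: "'a::euclidean_space \<Rightarrow> real"
  assumes m: "mesh_of \<Sigma> \<Omega>"
  obtains w where "w \<in> fe_space \<Sigma> \<Omega>" "\<And>x. x \<in> nodes \<Sigma> \<Longrightarrow> w x = f x"
proof -
  have "\<exists>a c. \<forall>x. x extreme_point_of \<sigma> \<longrightarrow> a \<bullet> x + c = f x" if "\<sigma> \<in> \<Sigma>" for \<sigma>
  proof -
    have "int DIM('a) simplex \<sigma>" using m that by (simp add: mesh_of_def)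
    then obtain C where C: "\<not> affine_dependent C" "\<sigma> = convex hull C"
      unfolding simplex_def by blast
    obtain a c where "\<And>x. x \<in> C \<Longrightarrow> a \<bullet> x + c = f x"
      using affine_interpolation[OF C(1)] by blast
    then show ?thesis
      unfolding C(2) using extreme_point_of_convex_hull by blast
  qed
  then obtain a c where ac: "\<And>\<sigma> x. \<sigma> \<in> \<Sigma> \<Longrightarrow> x extreme_point_of \<sigma> \<Longrightarrow> a \<sigma> \<bullet> x + c \<sigma> = f x"
    by metis
  have agree: "a \<sigma> \<bullet> x + c \<sigma> = a \<tau> \<bullet> x + c \<tau>" if "\<sigma> \<in> \<Sigma>" "\<tau> \<in> \<Sigma>" "x \<in> \<sigma>" "x \<in> \<tau>" for \<sigma> \<tau> x
  proof (rule affine_eq_on_hull[where S = "{z. z extreme_point_of \<sigma> \<inter> \<tau>}"])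
    note f = mesh_faces[OF m \<open>\<sigma> \<in> \<Sigma>\<close> \<open>\<tau> \<in> \<Sigma>\<close>]
    show "a \<sigma> \<bullet> z + c \<sigma> = a \<tau> \<bullet> z + c \<tau>" if "z \<in> {z. z extreme_point_of \<sigma> \<inter> \<tau>}" for z
    proof -
      have "z extreme_point_of \<sigma>" "z extreme_point_of \<tau>"
        using that extreme_point_of_face[OF f(1)] extreme_point_of_face[OF f(2)] by blast+
      then show ?thesis using ac \<open>\<sigma> \<in> \<Sigma>\<close> \<open>\<tau> \<in> \<Sigma>\<close> by metis
    qed
    show "x \<in> convex hull {z. z extreme_point_of \<sigma> \<inter> \<tau>}"
      using Krein_Milman_Minkowski[of "\<sigma> \<inter> \<tau>"] that mesh_simplexD[OF m]
      by (simp add: compact_Int convex_Int)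
  qed
  \<comment> \<open>By \<open>agree\<close> the choice of simplex does not matter on the mesh; off
    the mesh \<open>w\<close> is unspecified.\<close>
  define w where "w x = (let \<sigma> = SOME \<sigma>. \<sigma> \<in> \<Sigma> \<and> x \<in> \<sigma> in a \<sigma> \<bullet> x + c \<sigma>)" for x
  have w: "w x = a \<sigma> \<bullet> x + c \<sigma>" if "\<sigma> \<in> \<Sigma>" "x \<in> \<sigma>" for \<sigma> x
  proof -
    let ?\<tau> = "SOME \<sigma>. \<sigma> \<in> \<Sigma> \<and> x \<in> \<sigma>"
    have "?\<tau> \<in> \<Sigma> \<and> x \<in> ?\<tau>" by (rule someI[of _ \<sigma>]) (use that in blast)
    then show ?thesis using agree[of ?\<tau> \<sigma> x] that by (simp add: w_def)
  qed
  have "continuous_on (\<Union>\<Sigma>) w"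
  proof -
    have "continuous_on (\<Union>\<sigma>\<in>\<Sigma>. \<sigma>) w"
    proof (rule continuous_on_closed_Union)
      show "finite \<Sigma>" using m by (simp add: mesh_of_def triangulation_def)
      show "closed \<sigma>" if "\<sigma> \<in> \<Sigma>" for \<sigma>
        using that mesh_simplexD(1)[OF m] compact_imp_closed by blast
      show "continuous_on \<sigma> w" if "\<sigma> \<in> \<Sigma>" for \<sigma>
      proof -
        have "continuous_on \<sigma> (\<lambda>x. a \<sigma> \<bullet> x + c \<sigma>)" by (intro continuous_intros)
        then show ?thesis by (rule continuous_on_eq) (simp add: w[OF that])
      qed
    qed
    then show ?thesis by simp
  qed
  moreover have "\<exists>a c. \<forall>x\<in>\<sigma>. w x = a \<bullet> x + c" if "\<sigma> \<in> \<Sigma>" for \<sigma>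
    using w[OF that] by blast
  ultimately have "w \<in> fe_space \<Sigma> \<Omega>"
    using m by (simp add: fe_space_def mesh_of_def)
  moreover have "w x = f x" if x: "x \<in> nodes \<Sigma>" for x
  proof -
    obtain \<sigma> where \<sigma>: "\<sigma> \<in> \<Sigma>" "x extreme_point_of \<sigma>"
      using x by (auto simp: nodes_def)
    then have "x \<in> \<sigma>" by (simp add: extreme_point_of_def)
    then show ?thesis using w[OF \<sigma>(1)] ac[OF \<sigma>] by simp
  qed
  ultimately show ?thesis by (rule that)
qed

text \<open>\<open>hopf_lax\<close> is a choice by \<open>SOME\<close>, so its nodal values can be
  read off only once some admissible function exists; \<open>fe_interpolant\<close> supplies
  one.\<close>

lemma hopf_lax_node:
  assumes "mesh_of \<Sigma> \<Omega>" "open \<Omega>" "x \<in> nodes \<Sigma>" "x \<in> \<Omega>"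
  shows "hopf_lax H \<Sigma> \<Omega> u x = hopf_lax_value H \<Sigma> u x"
proof -
  obtain w where w: "w \<in> fe_space \<Sigma> \<Omega>"
    "\<And>x. x \<in> nodes \<Sigma> \<Longrightarrow> w x = (if x \<in> \<Omega> then hopf_lax_value H \<Sigma> u x else u x)"
    by (rule fe_interpolant[OF assms(1),
          where f = "\<lambda>x. if x \<in> \<Omega> then hopf_lax_value H \<Sigma> u x else u x"]) (rule that)
  let ?P = "\<lambda>w. w \<in> fe_space \<Sigma> \<Omega> \<and>
        (\<forall>x \<in> nodes \<Sigma> \<inter> \<Omega>. w x = hopf_lax_value H \<Sigma> u x) \<and>
        (\<forall>x \<in> nodes \<Sigma> \<inter> frontier \<Omega>. w x = u x)"
  have "\<Omega> \<inter> frontier \<Omega> = {}"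
    using assms(2) by (auto simp: frontier_def interior_open)
  then have "?P w"
    using w by auto
  then have "?P (hopf_lax H \<Sigma> \<Omega> u)"
    unfolding hopf_lax_def by (rule someI[where P = ?P])
  then show ?thesis using assms(3,4) by simp
qed

section \<open>The patch around an interior node\<close>

lemma frontier_patch:
  fixes x :: "'a::euclidean_space"
  assumes m: "mesh_of \<Sigma> \<Omega>" and \<Omega>: "open \<Omega>" "bounded \<Omega>" and x: "x \<in> nodes \<Sigma>" "x \<in> \<Omega>"
  shows "compact (frontier (patch \<Sigma> x))" "frontier (patch \<Sigma> x) \<noteq> {}"
    "frontier (patch \<Sigma> x) \<subseteq> closure \<Omega>" "x \<notin> frontier (patch \<Sigma> x)"
proof -
  let ?U = "\<Union>{\<sigma>\<in>\<Sigma>. x extreme_point_of \<sigma>}" and ?V = "\<Union>{\<sigma>\<in>\<Sigma>. \<not> x extreme_point_of \<sigma>}"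
  have fin: "finite \<Sigma>" using m by (simp add: mesh_of_def triangulation_def)
  have "closed \<sigma>" if "\<sigma> \<in> \<Sigma>" for \<sigma>
    by (rule compact_imp_closed[OF mesh_simplexD(1)[OF m that]])
  then have closed: "closed ?U" "closed ?V"
    using fin by (auto intro: closed_Union)
  have sub: "?U \<subseteq> closure \<Omega>"
    by (rule Union_least) (use mesh_simplexD(3)[OF m] in simp)
  have "closure (patch \<Sigma> x) \<subseteq> ?U"
    unfolding patch_def by (rule closure_minimal[OF interior_subset closed(1)])
  then have cl: "closure (patch \<Sigma> x) \<subseteq> closure \<Omega>"
    using sub by (rule order_trans)
  then show "frontier (patch \<Sigma> x) \<subseteq> closure \<Omega>"
    unfolding frontier_def by blast
  have "bounded (patch \<Sigma> x)"
    by (rule bounded_subset[OF bounded_closure[OF \<Omega>(2)] order_trans[OF closure_subset cl]])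
  then show "compact (frontier (patch \<Sigma> x))"
    by (rule compact_frontier_bounded)
  \<comment> \<open>A simplex containing \<open>x\<close> has \<open>x\<close> as a vertex, so
    \<open>\<Omega> - ?V\<close> is an open neighbourhood of \<open>x\<close>; it is covered by
    \<open>?U\<close>, which puts \<open>x\<close> in the interior of \<open>?U\<close>.\<close>
  have "x \<notin> ?V"
  proof
    assume "x \<in> ?V"
    then obtain \<tau> where \<tau>: "\<tau> \<in> \<Sigma>" "x \<in> \<tau>" "\<not> x extreme_point_of \<tau>" by blast
    obtain \<sigma> where "\<sigma> \<in> \<Sigma>" "x extreme_point_of \<sigma>"
      using x(1) by (auto simp: nodes_def)
    then show False using mesh_node_in_simplex[OF m _ \<tau>(1) _ \<tau>(2)] \<tau>(3) by blast
  qed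
  moreover have "\<Omega> - ?V \<subseteq> ?U"
  proof -
    have "\<Omega> \<subseteq> \<Union>\<Sigma>" using m closure_subset[of \<Omega>] by (simp add: mesh_of_def)
    then show ?thesis by blast
  qed
  ultimately have "x \<in> patch \<Sigma> x"
    unfolding patch_def using x(2) by (intro interiorI[OF open_Diff[OF \<Omega>(1) closed(2)]]) simp
  then show "x \<notin> frontier (patch \<Sigma> x)"
    by (simp add: frontier_def patch_def)
  have "patch \<Sigma> x \<noteq> UNIV"
    using \<open>bounded (patch \<Sigma> x)\<close> not_bounded_UNIV[where 'a = 'a] by auto
  then show "frontier (patch \<Sigma> x) \<noteq> {}"
    using \<open>x \<in> patch \<Sigma> x\<close> by (auto simp: frontier_eq_empty)
qed

section \<open>The support function and the minimum in the update formula\<close>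

lemma continuous_support_fun:
  fixes H :: "'a::euclidean_space \<Rightarrow> 'a \<Rightarrow> real"
  assumes H: "continuous_on UNIV (H x)" "filterlim (H x) at_top at_infinity" "H x 0 \<le> 0"
  shows "continuous_on UNIV (support_fun H x)"
proof -
  have "eventually (\<lambda>p. H x p > 0) at_infinity"
    using H(2) by (auto simp: filterlim_at_top_dense)
  then obtain b where b: "\<And>p. norm p \<ge> b \<Longrightarrow> H x p > 0"
    by (auto simp: eventually_at_infinity)
  \<comment> \<open>\<open>B\<close> bounds the sublevel set and serves as Lipschitz constant;
    \<open>max\<close> keeps it nonnegative.\<close>
  define B where "B = max b 0"
  have B: "norm p \<le> B" if "H x p \<le> 0" for p
    using b[of p] that by (force simp: B_def)
  \<comment> \<open>A maximiser \<open>p\<close> for \<open>q\<close> is still admissible for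
    \<open>r\<close>, so the difference is at most \<open>p \<bullet> (q - r)\<close>; exchanging
    \<open>q\<close> and \<open>r\<close> later gives the Lipschitz bound.\<close>
  have *: "support_fun H x q - support_fun H x r \<le> B * dist q r" for q r
  proof -
    obtain p where p: "H x p = 0" "support_fun H x q = p \<bullet> q"
      using support_fun_is_max(1)[where H=H and x=x and q=q] H by blast
    have "p \<bullet> r \<le> support_fun H x r"
      using support_fun_is_max(2)[where H=H and x=x and q=r] H p by simp
    then have "support_fun H x q - support_fun H x r \<le> p \<bullet> (q - r)"
      using p by (simp add: inner_diff_right)
    also have "\<dots> \<le> norm p * norm (q - r)" by (rule norm_cauchy_schwarz)
    also have "\<dots> \<le> B * dist q r"
      using B[of p] p by (simp add: dist_norm mult_right_mono)
    finally show ?thesis .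
  qed
  have "B-lipschitz_on UNIV (support_fun H x)"
  proof (rule lipschitz_onI)
    show "dist (support_fun H x q) (support_fun H x r) \<le> B * dist q r" for q r
      using *[of q r] *[of r q] by (simp add: dist_real_def dist_commute abs_le_iff)
  qed (simp add: B_def)
  then show ?thesis by (rule lipschitz_on_continuous_on)
qed

text \<open>Strict negativity at \<open>0\<close> puts a whole ball around \<open>0\<close> into the
  sublevel set of \<open>H x\<close>, hence a positive multiple of \<open>q\<close>.\<close>

lemma support_fun_pos:
  fixes H :: "'a::euclidean_space \<Rightarrow> 'a \<Rightarrow> real"
  assumes H: "continuous_on UNIV (H x)" "filterlim (H x) at_top at_infinity" "H x 0 < 0"
    and q: "q \<noteq> 0"
  shows "support_fun H x q > 0"
proof -
  have "open {p. H x p < 0}"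
    by (intro open_Collect_less H continuous_on_const)
  then obtain \<epsilon> where e: "\<epsilon> > 0" "\<And>y. dist y 0 < \<epsilon> \<Longrightarrow> H x y < 0"
    using H(3) unfolding open_dist by blast
  define p where "p = (\<epsilon> / (2 * norm q)) *\<^sub>R q"
  have "dist p 0 < \<epsilon>" using e(1) q by (simp add: p_def)
  then have "H x p \<le> 0" using e(2)[of p] by simp
  then have "p \<bullet> q \<le> support_fun H x q"
    using support_fun_is_max(2)[where H=H and x=x and q=q] H by simp
  moreover have "p \<bullet> q > 0"
    using e(1) q by (simp add: p_def)
  ultimately show ?thesis by linarith
qed

text \<open>\<open>LEAST\<close> yields the minimum only if the minimum is attained; here a
  continuous function is minimised over the compact nonempty frontier of the patch.\<close>

lemma hopf_lax_value_min:
  fixes x :: "'a::euclidean_space"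
  assumes m: "mesh_of \<Sigma> \<Omega>" and \<Omega>: "open \<Omega>" "bounded \<Omega>" and x: "x \<in> nodes \<Sigma>" "x \<in> \<Omega>"
    and H: "continuous_on UNIV (H x)" "filterlim (H x) at_top at_infinity" "H x 0 \<le> 0"
    and u: "continuous_on (closure \<Omega>) u"
  shows "\<exists>y\<in>frontier (patch \<Sigma> x). hopf_lax_value H \<Sigma> u x = u y + support_fun H x (x - y)"
    and "y \<in> frontier (patch \<Sigma> x) \<Longrightarrow> hopf_lax_value H \<Sigma> u x \<le> u y + support_fun H x (x - y)"
proof -
  note P = frontier_patch[OF m \<Omega> x]
  let ?g = "\<lambda>y. u y + support_fun H x (x - y)"
  have "continuous_on (frontier (patch \<Sigma> x)) ?g"
    by (intro continuous_intros continuous_on_subset[OF u P(3)]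
        continuous_on_compose2[OF continuous_support_fun[of H x, OF H]]) auto
  then obtain z where z: "z \<in> frontier (patch \<Sigma> x)" "\<And>y. y \<in> frontier (patch \<Sigma> x) \<Longrightarrow> ?g z \<le> ?g y"
    using continuous_attains_inf[OF P(1,2)] by blast
  have "hopf_lax_value H \<Sigma> u x = ?g z"
    unfolding hopf_lax_value_def using z by (intro Least_equality) auto
  with z show "\<exists>y\<in>frontier (patch \<Sigma> x). hopf_lax_value H \<Sigma> u x = ?g y"
    and "y \<in> frontier (patch \<Sigma> x) \<Longrightarrow> hopf_lax_value H \<Sigma> u x \<le> ?g y"
    by auto
qed

section \<open>Extremal nodes and the comparison argument\<close>

lemma max_min_node:
  fixes u v :: "'a::euclidean_space \<Rightarrow> real"
  assumes m: "mesh_of \<Sigma> \<Omega>" and \<Omega>: "bounded \<Omega>" "\<Omega> \<noteq> {}"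
    and u: "u \<in> fe_space \<Sigma> \<Omega>" and v: "v \<in> fe_space \<Sigma> \<Omega>"
  obtains x where "x \<in> nodes \<Sigma>" "\<And>y. y \<in> closure \<Omega> \<Longrightarrow> u y - v y \<le> u x - v x"
    "\<And>y. y \<in> closure \<Omega> \<Longrightarrow> u y - v y = u x - v x \<Longrightarrow> v x \<le> v y"
proof -
  have K: "compact (closure \<Omega>)" "closure \<Omega> \<noteq> {}"
    using \<Omega> by (auto simp: compact_closure)
  have cont: "continuous_on (closure \<Omega>) u" "continuous_on (closure \<Omega>) v"
    using u v by (auto simp: fe_space_def)
  then have cw: "continuous_on (closure \<Omega>) (\<lambda>y. u y - v y)"
    by (intro continuous_intros)
  obtain x0 where x0: "x0 \<in> closure \<Omega>" "\<And>y. y \<in> closure \<Omega> \<Longrightarrow> u y - v y \<le> u x0 - v x0"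
    using continuous_attains_sup[OF K cw] by blast
  \<comment> \<open>\<open>M\<close> collects all maximum points of \<open>u - v\<close>; by
    compactness \<open>v\<close> attains its minimum over \<open>M\<close>, at
    \<open>x1\<close>.\<close>
  define M where "M = {y \<in> closure \<Omega>. u y - v y = u x0 - v x0}"
  have "closed M"
    unfolding M_def by (rule continuous_closed_preimage_constant[OF cw closed_closure])
  then have "compact (closure \<Omega> \<inter> M)"
    using K(1) by (rule compact_Int_closed[rotated])
  then have M: "compact M" "M \<noteq> {}"
    using x0 by (auto simp: M_def Int_def)
  obtain x1 where x1: "x1 \<in> M" "\<And>y. y \<in> M \<Longrightarrow> v x1 \<le> v y"
    using continuous_attains_inf[OF M continuous_on_subset[OF cont(2)]] by (auto simp: M_def)
  then have "x1 \<in> \<Union>\<Sigma>"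
    using m by (simp add: M_def mesh_of_def)
  then obtain \<sigma> where \<sigma>: "\<sigma> \<in> \<Sigma>" "x1 \<in> \<sigma>" by blast
  have fe: "\<exists>a c. \<forall>x\<in>\<sigma>. w x = a \<bullet> x + c" if "w \<in> fe_space \<Sigma> \<Omega>" for w
    using that \<sigma>(1) by (simp add: fe_space_def)
  obtain a c where au: "\<forall>x\<in>\<sigma>. u x = a \<bullet> x + c"
    using fe[OF u] by blast
  obtain a' c' where av: "\<forall>x\<in>\<sigma>. v x = a' \<bullet> x + c'"
    using fe[OF v] by blast
  note s = mesh_simplexD[OF m \<sigma>(1)]
  have w: "u x - v x = (a - a') \<bullet> x + (c - c')" if "x \<in> \<sigma>" for x
    using au av that by (simp add: inner_diff_left)
  have le: "u x - v x \<le> u x1 - v x1" if "x \<in> \<sigma>" for x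
  proof -
    have "u x - v x \<le> u x0 - v x0" using that s(3) by (intro x0(2)) blast
    also have "\<dots> = u x1 - v x1" using x1(1) by (simp add: M_def)
    finally show ?thesis .
  qed
  \<comment> \<open>On \<open>\<sigma>\<close> the affine \<open>u - v\<close> is largest at
    \<open>x1\<close>, so one can move to a vertex \<open>z\<close> that stays in \<open>M\<close>
    with \<open>v\<close> no larger, hence again minimal there.\<close>
  obtain z where z: "z extreme_point_of \<sigma>" "u z - v z = u x1 - v x1" "v z \<le> v x1"
    by (rule extreme_point_face_min[where w = "\<lambda>x. u x - v x",
          OF s(1,2) \<sigma>(2) w le bspec[OF av]])
  have eq: "u z - v z = u x0 - v x0"
    using z(2) x1(1) by (simp add: M_def)
  show ?thesis
  proof
    show "z \<in> nodes \<Sigma>" unfolding nodes_def using z(1) \<sigma>(1) by blast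
    show "u y - v y \<le> u z - v z" if "y \<in> closure \<Omega>" for y
      using x0(2)[OF that] eq by simp
    show "v z \<le> v y" if "y \<in> closure \<Omega>" "u y - v y = u z - v z" for y
      using that x1(2)[of y] z(3) eq by (simp add: M_def)
  qed
qed

theorem theorem7:
  fixes \<Omega> :: "(real ^ 'd) set"
    and \<Sigma> :: "(real ^ 'd) set set"
    and H :: "real ^ 'd \<Rightarrow> real ^ 'd \<Rightarrow> real"
    and u v :: "real ^ 'd \<Rightarrow> real"
  assumes "bounded_polytopal_lipschitz_domain \<Omega>"
    and "mesh_of \<Sigma> \<Omega>"
    and "continuous_on (closure \<Omega> \<times> UNIV) (\<lambda>(x, p). H x p)"
    and "\<And>x. x \<in> closure \<Omega> \<Longrightarrow> convex_on UNIV (H x)"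
    and "\<And>C. \<forall>\<^sub>F p in at_infinity. \<forall>x\<in>closure \<Omega>. H x p \<ge> C"
    and "\<And>x. x \<in> \<Omega> \<Longrightarrow> H x 0 < 0"
    and "fe_subsolution H \<Sigma> \<Omega> u"
    and "fe_supersolution H \<Sigma> \<Omega> v"
    and "\<forall>x \<in> nodes \<Sigma> \<inter> frontier \<Omega>. u x \<le> v x"
  shows "\<forall>x\<in>closure \<Omega>. u x \<le> v x"
proof -
  have \<Omega>: "open \<Omega>" "bounded \<Omega>" "\<Omega> \<noteq> {}"
    using assms(1) by (auto simp: bounded_polytopal_lipschitz_domain_def)
  have fe: "u \<in> fe_space \<Sigma> \<Omega>" "v \<in> fe_space \<Sigma> \<Omega>"
    using assms(7,8) by (auto simp: fe_subsolution_def fe_supersolution_def)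
  then have cont: "continuous_on (closure \<Omega>) u" "continuous_on (closure \<Omega>) v"
    by (auto simp: fe_space_def)
  obtain x where x: "x \<in> nodes \<Sigma>" "\<And>y. y \<in> closure \<Omega> \<Longrightarrow> u y - v y \<le> u x - v x"
    "\<And>y. y \<in> closure \<Omega> \<Longrightarrow> u y - v y = u x - v x \<Longrightarrow> v x \<le> v y"
    using max_min_node[OF assms(2) \<Omega>(2,3) fe] by blast
  \<comment> \<open>An extremal node in \<open>\<Omega>\<close> is contradictory whatever the sign
    of the maximum; the boundary values enter only afterwards.\<close>
  have "x \<notin> \<Omega>"
  proof
    assume "x \<in> \<Omega>"
    then have xc: "x \<in> closure \<Omega>" using closure_subset by blast
    \<comment> \<open>Freezing \<open>x\<close> in the joint continuity and in the uniform growth of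
      \<open>H\<close> gives the pointwise conditions under which the support function was
      studied.\<close>
    have "continuous_on UNIV (\<lambda>p. case (x, p) of (x, p) \<Rightarrow> H x p)"
      by (rule continuous_on_compose2[OF assms(3)]) (use xc in \<open>auto intro!: continuous_intros\<close>)
    then have H: "continuous_on UNIV (H x)" by simp
    have lim: "filterlim (H x) at_top at_infinity"
      unfolding filterlim_at_top using xc by (auto intro: eventually_mono[OF assms(5)])
    note H = H lim assms(6)[OF \<open>x \<in> \<Omega>\<close>]
    note P = frontier_patch[OF assms(2) \<Omega>(1,2) x(1) \<open>x \<in> \<Omega>\<close>]
    note min = hopf_lax_value_min[where H=H, OF assms(2) \<Omega>(1,2) x(1) \<open>x \<in> \<Omega>\<close> H(1,2) less_imp_le[OF H(3)]]
    note node = hopf_lax_node[OF assms(2) \<Omega>(1) x(1) \<open>x \<in> \<Omega>\<close>, of H]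
    \<comment> \<open>\<open>y\<close> is a minimiser for \<open>v\<close> and a mere competitor for
      \<open>u\<close>, so both inequalities below carry the same term
      \<open>support_fun H x (x - y)\<close>.\<close>
    obtain y where y: "y \<in> frontier (patch \<Sigma> x)"
        "hopf_lax_value H \<Sigma> v x = v y + support_fun H x (x - y)"
      using min(1)[OF cont(2)] by blast
    have vy: "v y + support_fun H x (x - y) \<le> v x"
      using assms(8) xc node[of v] y(2) by (auto simp: fe_supersolution_def)
    have "u x \<le> hopf_lax_value H \<Sigma> u x"
      using assms(7) xc node[of u] by (auto simp: fe_subsolution_def)
    also have "\<dots> \<le> u y + support_fun H x (x - y)"
      by (rule min(2)[OF cont(1) y(1)])
    finally have uy: "u x \<le> u y + support_fun H x (x - y)" .
    have yc: "y \<in> closure \<Omega>" using y(1) P(3) by blast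
    \<comment> \<open>Subtracting cancels that term: \<open>u x - v x \<le> u y - v y\<close>. By
      maximality \<open>y\<close> is then another maximum point, and the choice of \<open>x\<close>
      applies.\<close>
    have "v x \<le> v y"
      using x(3)[OF yc] x(2)[OF yc] uy vy by linarith
    \<comment> \<open>\<open>y \<noteq> x\<close>, because \<open>x\<close> is not on the frontier
      of its own patch.\<close>
    moreover have "support_fun H x (x - y) > 0"
      using P(4) y(1) by (intro support_fun_pos H) auto
    ultimately show False using vy by linarith
  qed
  moreover have "x \<in> closure \<Omega>"
    using x(1) mesh_simplexD(3)[OF assms(2)] by (auto simp: nodes_def extreme_point_of_def)
  \<comment> \<open>A node in the closure but outside the open \<open>\<Omega>\<close> is a boundary
    node; the maximum of \<open>u - v\<close> is therefore nonpositive.\<close>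
  ultimately have "u x \<le> v x"
    using assms(9) x(1) \<Omega>(1) by (simp add: frontier_def interior_open)
  then show ?thesis using x(2) by fastforce
qed

end
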